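(* Let $(a_n)_{n\ge 0}\in\mathbb{Z}^{\mathbb{N}}$ be a primary pseudo-polynomial such that $a_0=1$. Define $(b_n)_{n\ge 0}$ by $b_n:=\sum_{k=0}^n(-1)^{n-k}\binom{n}{k}a_k$ (so that $b_0=1$), define $(c_n)_{n\ge 0}$ by the identity of formal power series $$\sum_{n=0}^\infty\frac{c_n}{n!}x^n=\left(\sum_{n=0}^\infty\frac{b_n}{n!}x^n\right)^{-1},$$ and define $(u_n)_{n\ge 0}$ by $u_n:=\sum_{k=0}^n\binom{n}{k}c_k$. Then $(u_n)_{n\ge 0}\in\mathbb{Z}^{\mathbb{N}}$ and $(u_n)_{n\ge 0}$ is a primary pseudo-polynomial. Moreover, assuming also that $f_a(x):=\sum_{n=0}^\infty a_nx^n$ is a $G$-function, if $\limsup_{n\to+\infty}|u_n|^{1/n}<e$, then $a_n=u_n=1$ for all $n\ge 0$.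
   Context: $\mathbb{N}=\{0,1,2,\dots\}$. A sequence $(a_n)_{n\ge 0}\in\mathbb{Z}^{\mathbb{N}}$ is a primary pseudo-polynomial if for every integer $n\ge 0$ and every prime number $p$, $a_{n+p}\equiv a_n \pmod p$. A power series $\sum_{n=0}^\infty v_nx^n\in\overline{\mathbb{Q}}[[x]]$ is a $G$-function if it is a solution of a non-zero linear differential equation with coefficients in $\overline{\mathbb{Q}}(x)$ and there exists $C\ge 1$ such that, for all $n\ge 0$, both the maximum of the moduli of all the Galois conjugates of $v_0,\dots,v_n$ and the positive (common) denominator of $v_0,\dots,v_n$ (i.e. the least positive integer $D_n$ such that $D_nv_0,\dots,D_nv_n$ are algebraic integers) are bounded by $C^{n+1}$. Here $e$ is the base of the natural logarithm. *)

theory Defs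
  imports
    "HOL-Analysis.Analysis"
    "HOL-Computational_Algebra.Computational_Algebra"
    "HOL-Number_Theory.Cong"
begin

definition primary_pseudo_polynomial :: "(nat \<Rightarrow> int) \<Rightarrow> bool" where
  "primary_pseudo_polynomial a \<longleftrightarrow>
     (\<forall>n p :: nat. prime p \<longrightarrow> [a (n + p) = a n] (mod int p))"

text \<open>The field of algebraic numbers is taken inside the complex numbers. The Galois
  conjugates of an algebraic number are the complex roots of its minimal polynomial,
  which is an irreducible rational polynomial vanishing at it (unique up to a unit).\<close>

definition galois_conjugates :: "complex \<Rightarrow> complex set" where
  "galois_conjugates z =
     {w. \<exists>p :: rat poly. irreducible p \<and>
           poly (map_poly of_rat p) z = 0 \<and> poly (map_poly of_rat p) w = 0}"

definition max_conjugate_modulus :: "(nat \<Rightarrow> complex) \<Rightarrow> nat \<Rightarrow> real" where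
  "max_conjugate_modulus v n = Max (\<Union>i\<in>{..n}. cmod ` galois_conjugates (v i))"

definition common_denominator :: "(nat \<Rightarrow> complex) \<Rightarrow> nat \<Rightarrow> nat" where
  "common_denominator v n =
     (LEAST D. D > 0 \<and> (\<forall>i\<le>n. algebraic_int (of_nat D * v i)))"

text \<open>Rational functions with algebraic coefficients, embedded into the field of formal
  Laurent series, where they can act on power series even if they have a pole at 0.\<close>

definition algebraic_rational_functions :: "complex fls set" where
  "algebraic_rational_functions =
     {fps_to_fls (fps_of_poly p) / fps_to_fls (fps_of_poly q) | p q.
        (\<forall>i. algebraic (coeff p i)) \<and> (\<forall>i. algebraic (coeff q i)) \<and> q \<noteq> 0}"

definition satisfies_linear_ode :: "complex fps \<Rightarrow> bool" where
  "satisfies_linear_ode f \<longleftrightarrow>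
     (\<exists>r :: nat. \<exists>A :: nat \<Rightarrow> complex fls.
        (\<forall>i\<le>r. A i \<in> algebraic_rational_functions) \<and> (\<exists>i\<le>r. A i \<noteq> 0) \<and>
        (\<Sum>i\<le>r. A i * (fls_deriv ^^ i) (fps_to_fls f)) = 0)"

text \<open>Algebraicity of all coefficients guarantees that the maximum and the least element
  above are taken over suitable nonempty (and, for the maximum, finite) sets.\<close>

definition G_function :: "complex fps \<Rightarrow> bool" where
  "G_function f \<longleftrightarrow>
     (\<forall>n. algebraic (fps_nth f n)) \<and>
     satisfies_linear_ode f \<and>
     (\<exists>C :: real. C \<ge> 1 \<and>
        (\<forall>n. max_conjugate_modulus (fps_nth f) n \<le> C ^ (n + 1) \<and>
             real (common_denominator (fps_nth f) n) \<le> C ^ (n + 1)))"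

end

theory Submission imports Defs "HOL-Complex_Analysis.Complex_Analysis"
begin

text \<open>
  Write \<open>A\<close>, \<open>B\<close>, \<open>C\<close>, \<open>U\<close> for the exponential generating functions of the four sequences.
  The binomial sums say \<open>B = e\<^sup>-\<^sup>x A\<close> and \<open>U = e\<^sup>x C\<close>, so \<open>C = 1 / B\<close> amounts to the symmetric
  relation \<open>A U = e\<^sup>2\<^sup>x\<close>.

  The arithmetic half rests on the characterisation of primary pseudo-polynomials by their
  Newton coefficients: \<open>a\<close> is one iff \<open>p\<close> divides \<open>b\<^sub>n\<close> for all primes \<open>p \<le> n\<close>
  (\<open>primary_imp_newton_coeff_dvd\<close> and \<open>newton_coeff_dvd_imp_primary\<close>). This divisibility
  passes from \<open>B\<close> to \<open>1 / B\<close> (\<open>reciprocal_egf_coeff_dvd\<close>), because in each term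
  \<open>binom(n,k) b\<^sub>k c\<^bsub>n-k\<^esub>\<close> of the recurrence for \<open>c\<^sub>n\<close> either one of the indices \<open>k\<close>, \<open>n - k\<close>
  is at least \<open>p\<close>, or adding them in base \<open>p\<close> carries and \<open>p\<close> divides the binomial coefficient.

  For the rigidity half, the bound on conjugates in the definition of a \<open>G\<close>-function reads
  \<open>\<bar>a\<^sub>n\<bar> \<le> D\<^bsup>n+1\<^esup>\<close>, an integer being its own only conjugate; the condition on the upper
  limit bounds \<open>u\<^sub>n\<close> in the same way. Hence \<open>A\<close> and \<open>U\<close> are entire, \<open>A\<close> has exponential type,
  and \<open>A U = e\<^sup>2\<^sup>x\<close> shows that \<open>A\<close> has no zeros. An entire
  function of exponential type without zeros is \<open>A(0) e\<^bsup>\<alpha>x\<^esup>\<close> (\<open>zero_free_exponential_type\<close>, the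
  simplest case of Hadamard factorisation), so \<open>a\<^sub>n = r\<^sup>n\<close> with \<open>r = a\<^sub>1\<close> an integer. Then
  \<open>b\<^sub>p = (r - 1)\<^sup>p\<close> is divisible by \<open>p\<close> for every prime \<open>p\<close>, which forces \<open>r = 1\<close>; finally
  \<open>U = e\<^sup>2\<^sup>x / e\<^sup>x\<close> gives \<open>u\<^sub>n = 1\<close>.
\<close>

section \<open>Exponential generating functions\<close>

definition egf :: "(nat \<Rightarrow> 'a::field_char_0) \<Rightarrow> 'a fps" where
  "egf f = Abs_fps (\<lambda>n. f n / fact n)"

lemma egf_nth [simp]: "fps_nth (egf f) n = f n / fact n"
  by (simp add: egf_def)

lemma egf_eq_iff: "egf f = egf g \<longleftrightarrow> f = g"
  by (auto simp: fps_eq_iff)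

lemma egf_mult:
  "egf f * egf g = egf (\<lambda>n. \<Sum>k\<le>n. of_nat (n choose k) * f k * g (n - k))"
proof (rule fps_ext)
  fix n
  have "f k / fact k * (g (n - k) / fact (n - k)) =
        of_nat (n choose k) * f k * g (n - k) / fact n" if "k \<le> n" for k
    using that by (simp add: binomial_fact field_simps)
  then show "fps_nth (egf f * egf g) n =
      fps_nth (egf (\<lambda>n. \<Sum>k\<le>n. of_nat (n choose k) * f k * g (n - k))) n"
    by (simp add: fps_mult_nth atLeast0AtMost sum_divide_distrib)
qed

lemma egf_power: "egf (\<lambda>n. x ^ n) = fps_exp x"
  by (rule fps_ext) simp

section \<open>Primary pseudo-polynomials and their Newton coefficients\<close>

text \<open>The easy case of Kummer's theorem: \<open>p\<close> divides \<open>n!\<close> but neither of the two factorials in the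
  denominator.\<close>

lemma prime_dvd_choose_carry:
  fixes p :: nat
  assumes "prime p" "k < p" "n - k < p" "p \<le> n"
  shows "p dvd (n choose k)"
proof -
  have "fact k * fact (n - k) * (n choose k) = (fact n :: nat)"
    using assms by (intro binomial_fact_lemma) simp
  moreover have "p dvd (fact n :: nat)" "\<not> p dvd (fact k :: nat)" "\<not> p dvd (fact (n - k) :: nat)"
    using assms by (simp_all add: prime_dvd_fact_iff)
  ultimately show ?thesis
    using assms(1) by (metis prime_dvd_mult_iff)
qed

text \<open>Evaluating the Newton coefficients at an arbitrary base point \<open>m\<close> makes them iterates of the
  operator \<open>\<Delta>\<close>, so that a congruence for \<open>\<Delta>\<^sup>p\<close> carries over to all higher iterates.\<close>

lemma forward_difference_iterate:
  fixes a :: "nat \<Rightarrow> int"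
  defines "\<Delta> \<equiv> \<lambda>f m. f (Suc m) - f m"
  shows "(\<Delta> ^^ n) a m = (\<Sum>k\<le>n. (-1) ^ (n - k) * int (n choose k) * a (m + k))"
proof (induction n arbitrary: m)
  case 0
  then show ?case by simp
next
  case (Suc n)
  let ?s = "\<lambda>n k. (-1) ^ (n - k) * int (n choose k)"
  have "(\<Sum>k\<le>Suc n. ?s (Suc n) k * a (m + k)) =
      ?s (Suc n) 0 * a m + (\<Sum>k\<le>n. ?s (Suc n) (Suc k) * a (m + Suc k))"
    by (subst sum.atMost_Suc_shift) simp
  also have "(\<Sum>k\<le>n. ?s (Suc n) (Suc k) * a (m + Suc k)) =
      (\<Sum>k\<le>n. ?s n k * a (Suc m + k)) +
      (\<Sum>k\<le>n. (-1) ^ (n - k) * int (n choose Suc k) * a (m + Suc k))"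
    by (simp add: algebra_simps sum.distrib)
  also have "(\<Sum>k\<le>n. (-1) ^ (n - k) * int (n choose Suc k) * a (m + Suc k)) =
      (\<Sum>k<n. (-1) ^ (n - k) * int (n choose Suc k) * a (m + Suc k))"
    by (simp flip: lessThan_Suc_atMost)
  also have "\<dots> = - (\<Sum>k<n. ?s n (Suc k) * a (m + Suc k))"
  proof -
    have "(-1) ^ (n - k) = - ((-1) ^ (n - Suc k) :: int)" if "k < n" for k
      using that by (simp flip: Suc_diff_Suc)
    then show ?thesis
      by (simp flip: sum_negf)
  qed
  finally have "(\<Sum>k\<le>Suc n. ?s (Suc n) k * a (m + k)) =
      (\<Sum>k\<le>n. ?s n k * a (Suc m + k)) -
      (?s n 0 * a m + (\<Sum>k<n. ?s n (Suc k) * a (m + Suc k)))"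
    by simp
  also have "?s n 0 * a m + (\<Sum>k<n. ?s n (Suc k) * a (m + Suc k)) = (\<Sum>k\<le>n. ?s n k * a (m + k))"
    by (simp add: sum.atMost_shift)
  finally show ?case
    by (simp add: \<Delta>_def Suc.IH[unfolded \<Delta>_def])
qed

text \<open>Modulo \<open>p\<close> only the two extreme terms of \<open>\<Delta>\<^sup>p a\<close> survive, and they give
  \<open>a\<^bsub>m+p\<^esub> + (-1)\<^sup>p a\<^sub>m\<close>, which vanishes by the congruence \<open>a\<^bsub>m+p\<^esub> \<equiv> a\<^sub>m\<close> (for \<open>p = 2\<close> the wrong sign
  is harmless). Being divisible by \<open>p\<close> everywhere, \<open>\<Delta>\<^sup>p a\<close> stays so under further differences.\<close>

lemma primary_imp_newton_coeff_dvd: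
  fixes a :: "nat \<Rightarrow> int" and p :: nat
  assumes a: "primary_pseudo_polynomial a" and p: "prime p" "p \<le> n"
  shows "int p dvd (\<Sum>k\<le>n. (-1) ^ (n - k) * int (n choose k) * a k)"
proof -
  define \<Delta> :: "(nat \<Rightarrow> int) \<Rightarrow> nat \<Rightarrow> int" where "\<Delta> = (\<lambda>f m. f (Suc m) - f m)"
  note iterate = forward_difference_iterate[folded \<Delta>_def]
  have base: "int p dvd (\<Delta> ^^ p) a m" for m
  proof -
    obtain q where q: "p = Suc q"
      using p prime_gt_0_nat not0_implies_Suc by blast
    have "int p dvd (\<Sum>k<q. (-1) ^ (p - Suc k) * int (p choose Suc k) * a (m + Suc k))"
    proof (intro dvd_sum)
      fix k assume "k \<in> {..<q}"
      then have "p dvd (p choose Suc k)"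
        using p q by (intro dvd_choose_prime) auto
      then show "int p dvd (-1) ^ (p - Suc k) * int (p choose Suc k) * a (m + Suc k)"
        by simp
    qed
    moreover have "int p dvd a (m + p) + (-1) ^ p * a m"
    proof -
      have ap: "int p dvd a (m + p) - a m"
        using a p by (simp add: primary_pseudo_polynomial_def cong_iff_dvd_diff)
      show ?thesis
      proof (cases "p = 2")
        case True
        then have "int p dvd (a (m + p) - a m) + 2 * a m"
          using ap by (intro dvd_add) auto
        then show ?thesis
          using True by (simp add: algebra_simps)
      next
        case False
        then show ?thesis
          using ap p prime_odd_nat[of p] prime_ge_2_nat[of p] by simp
      qed
    qed
    moreover have "(\<Delta> ^^ p) a m = (a (m + p) + (-1) ^ p * a m) +
        (\<Sum>k<q. (-1) ^ (p - Suc k) * int (p choose Suc k) * a (m + Suc k))"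
    proof -
      have "(\<Delta> ^^ p) a m = (\<Sum>k\<le>Suc q. (-1) ^ (p - k) * int (p choose k) * a (m + k))"
        by (simp only: iterate q)
      also have "\<dots> = (-1) ^ p * a m +
          (\<Sum>k<Suc q. (-1) ^ (p - Suc k) * int (p choose Suc k) * a (m + Suc k))"
        by (subst sum.atMost_shift) simp
      finally show ?thesis
        by (simp add: q)
    qed
    ultimately show ?thesis
      by (simp only: dvd_add)
  qed
  have "int p dvd (\<Delta> ^^ (j + p)) a m" for j m
  proof (induction j arbitrary: m)
    case 0
    then show ?case by (simp only: add_0 base)
  next
    case (Suc j)
    have "(\<Delta> ^^ (Suc j + p)) a m = \<Delta> ((\<Delta> ^^ (j + p)) a) m"
      by simp
    also have "\<dots> = (\<Delta> ^^ (j + p)) a (Suc m) - (\<Delta> ^^ (j + p)) a m"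
      by (simp only: \<Delta>_def)
    finally have "(\<Delta> ^^ (Suc j + p)) a m = (\<Delta> ^^ (j + p)) a (Suc m) - (\<Delta> ^^ (j + p)) a m" .
    then show ?case
      by (simp only: Suc.IH dvd_diff)
  qed
  from this[of "n - p" 0] show ?thesis
    using p by (simp only: iterate le_add_diff_inverse2 add_0)
qed

text \<open>The constant term 1 means that the recurrence for the reciprocal needs no division: the
  binomial weights stay integral on the level of exponential generating functions.\<close>

lemma reciprocal_egf_coeff_int:
  fixes b :: "nat \<Rightarrow> int" and c :: "nat \<Rightarrow> real"
  assumes b0: "b 0 = 1" and inv: "egf (\<lambda>n. of_int (b n)) * egf c = 1"
  obtains d :: "nat \<Rightarrow> int" where "\<And>n. c n = of_int (d n)"
proof -
  have "c n \<in> \<int>" for n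
  proof (induction n rule: less_induct)
    case (less n)
    let ?s = "\<Sum>k<n. of_nat (n choose Suc k) * of_int (b (Suc k)) * c (n - Suc k)"
    have "(\<Sum>k\<le>n. of_nat (n choose k) * of_int (b k) * c (n - k)) = c n + ?s"
      by (subst sum.atMost_shift) (simp add: b0)
    moreover have "fps_nth (egf (\<lambda>n. of_int (b n)) * egf c) n = (if n = 0 then 1 else 0)"
      by (simp add: inv)
    ultimately have "c n = (if n = 0 then 1 else 0) - ?s"
      unfolding egf_mult by (simp split: if_splits)
    also have "\<dots> \<in> \<int>"
      using less by (intro Ints_diff Ints_sum Ints_mult) auto
    finally show ?case .
  qed
  then have "\<forall>n. \<exists>z. c n = of_int z"
    by (auto simp: Ints_def)
  then show ?thesis
    using that by metis
qed

text \<open>The recurrence expresses \<open>d\<^sub>n\<close> through terms \<open>binom(n,k) b\<^sub>k d\<^bsub>n-k\<^esub>\<close> with \<open>k > 0\<close>. The factor \<open>p\<close> comes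
  from \<open>b\<^sub>k\<close>, from \<open>d\<^bsub>n-k\<^esub>\<close> by induction, or from the binomial coefficient if both indices are
  smaller than \<open>p\<close>.\<close>

lemma reciprocal_egf_coeff_dvd:
  fixes b d :: "nat \<Rightarrow> int" and p :: nat
  assumes b0: "b 0 = 1"
    and conv: "\<And>n. n > 0 \<Longrightarrow> (\<Sum>k\<le>n. int (n choose k) * b k * d (n - k)) = 0"
    and p: "prime p" and b: "\<And>n. p \<le> n \<Longrightarrow> int p dvd b n"
    and "p \<le> n"
  shows "int p dvd d n"
  using \<open>p \<le> n\<close>
proof (induction n rule: less_induct)
  case (less n)
  obtain m where m: "n = Suc m"
    using less.prems p prime_gt_0_nat[of p] by (cases n) auto
  have "(\<Sum>k\<le>n. int (n choose k) * b k * d (n - k)) =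
      d n + (\<Sum>k<n. int (n choose Suc k) * b (Suc k) * d (n - Suc k))"
    by (subst sum.atMost_shift) (simp add: b0)
  then have eq: "d n = - (\<Sum>k<n. int (n choose Suc k) * b (Suc k) * d (n - Suc k))"
    using conv[of n] m by simp
  have "int p dvd int (n choose k) * b k * d (n - k)" if "k > 0" "k \<le> n" for k
  proof -
    consider "p \<le> k" | "p \<le> n - k" | "k < p" "n - k < p"
      by linarith
    then show ?thesis
    proof cases
      case 1
      then show ?thesis using b by simp
    next
      case 2
      then show ?thesis using less.IH[of "n - k"] that by simp
    next
      case 3
      then show ?thesis
        using prime_dvd_choose_carry[OF p _ _ less.prems] by simp
    qed
  qed
  then show ?case
    unfolding eq dvd_minus_iff by (intro dvd_sum) auto
qed

text \<open>Vandermonde's identity, in which all \<open>binom(p,j)\<close> with \<open>0 < j < p\<close> vanish modulo \<open>p\<close>.\<close>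

lemma choose_add_prime_cong:
  fixes p :: nat
  assumes "prime p" "k < p"
  shows "[(n + p) choose k = n choose k] (mod p)"
proof -
  have "(n + p) choose k = (\<Sum>j\<le>k. (p choose j) * (n choose (k - j)))"
    by (simp add: vandermonde add.commute)
  also have "\<dots> = (n choose k) + (\<Sum>j<k. (p choose Suc j) * (n choose (k - Suc j)))"
    by (simp add: sum.atMost_shift)
  finally have "(n + p) choose k = (n choose k) + (\<Sum>j<k. (p choose Suc j) * (n choose (k - Suc j)))" .
  moreover have "p dvd (\<Sum>j<k. (p choose Suc j) * (n choose (k - Suc j)))"
    using assms by (intro dvd_sum dvd_mult2 dvd_choose_prime) auto
  ultimately show ?thesis
    by (simp add: cong_def mod_add_right_eq[symmetric])
qed

text \<open>Modulo \<open>p\<close> the sum is truncated at \<open>k < p\<close>, where \<open>binom(n,k)\<close> is periodic in \<open>n\<close> with period \<open>p\<close>.\<close>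

lemma newton_coeff_dvd_imp_primary:
  fixes d :: "nat \<Rightarrow> int"
  assumes d: "\<And>p n. prime p \<Longrightarrow> p \<le> n \<Longrightarrow> int p dvd d n"
  shows "primary_pseudo_polynomial (\<lambda>n. \<Sum>k\<le>n. int (n choose k) * d k)"
  unfolding primary_pseudo_polynomial_def
proof (intro allI impI)
  fix n p :: nat
  assume p: "prime p"
  have "(\<Sum>k\<le>n. int (n choose k) * d k) = (\<Sum>k\<le>n+p. int (n choose k) * d k)"
    by (intro sum.mono_neutral_left) auto
  moreover have "[int ((n + p) choose k) * d k = int (n choose k) * d k] (mod int p)" for k
  proof (cases "k < p")
    case True
    then show ?thesis
      using choose_add_prime_cong[OF p True, of n] by (intro cong_mult) (simp_all add: cong_int_iff)
  next
    case False
    then show ?thesis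
      using d[OF p, of k] by (simp add: cong_iff_dvd_diff flip: left_diff_distrib)
  qed
  ultimately show "[(\<Sum>k\<le>n+p. int ((n + p) choose k) * d k) = (\<Sum>k\<le>n. int (n choose k) * d k)] (mod int p)"
    by (simp add: cong_sum)
qed

section \<open>Zero-free entire functions of exponential type\<close>

text \<open>The map \<open>w \<mapsto> w / (2M - w)\<close> sends the half-plane \<open>Re w < M\<close> into the unit disc and fixes 0, so
  Schwarz's lemma applies to its composition with \<open>g\<close>. The radius \<open>R / 2\<close> is chosen to make the
  resulting inequality \<open>2 \<bar>g z\<bar> \<le> \<bar>2M - g z\<bar>\<close> solvable for \<open>\<bar>g z\<bar>\<close>.\<close>

lemma Borel_Caratheodory_half:
  assumes hol: "g holomorphic_on UNIV" and g0: "g 0 = 0" and R: "R > 0"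
    and M: "M > 0" "\<And>z. norm z < R \<Longrightarrow> Re (g z) < M"
    and z: "norm z \<le> R / 2"
  shows "norm (g z) \<le> 2 * M"
proof -
  define h where "h = (\<lambda>\<xi>. g (of_real R * \<xi>) / (of_real (2 * M) - g (of_real R * \<xi>)))"
  \<comment> \<open>The half-plane consists of points closer to 0 than to \<open>2M\<close>.\<close>
  have bound: "norm (g w) < norm (of_real (2 * M) - g w) \<and> of_real (2 * M) - g w \<noteq> 0"
    if "norm w < R" for w
  proof -
    have "(norm (of_real (2 * M) - g w))\<^sup>2 - (norm (g w))\<^sup>2 = 4 * M * (M - Re (g w))"
      unfolding cmod_power2 by (simp add: power2_eq_square algebra_simps)
    moreover have "\<dots> > 0"
      using M that by simp
    ultimately have "norm (g w) < norm (of_real (2 * M) - g w)"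
      by (intro power2_less_imp_less[of "norm (g w)"]) simp_all
    then show ?thesis
      by auto
  qed
  have scale: "norm (of_real R * \<xi>) < R" if "norm \<xi> < 1" for \<xi> :: complex
    using that R by (simp add: norm_mult)
  have "(\<lambda>\<xi>. g (of_real R * \<xi>)) holomorphic_on ball 0 1"
    by (intro holomorphic_on_compose_gen[OF _ hol, unfolded o_def] holomorphic_intros) auto
  then have holh: "h holomorphic_on ball 0 1"
    unfolding h_def using bound scale by (intro holomorphic_intros) auto
  have h1: "norm (h \<xi>) < 1" if "norm \<xi> < 1" for \<xi>
    using bound[OF scale[OF that]] by (auto simp: h_def norm_divide)
  have nz: "norm (z / of_real R) \<le> 1 / 2"
    using z R by (simp add: norm_divide field_simps)
  have "norm (h (z / of_real R)) \<le> norm (z / of_real R)"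
    using nz by (intro Schwarz_Lemma(1)[OF holh _ h1]) (auto simp: h_def g0)
  with nz have "norm (h (z / of_real R)) \<le> 1 / 2"
    by linarith
  moreover have "norm (of_real (2 * M) - g z) > 0"
    using bound[of z] z R by auto
  ultimately have "2 * norm (g z) \<le> norm (of_real (2 * M) - g z)"
    using R by (simp add: h_def norm_divide field_simps)
  also have "\<dots> \<le> 2 * M + norm (g z)"
    using M by (metis abs_of_pos mult_pos_pos norm_of_real norm_triangle_ineq4 zero_less_numeral)
  finally show ?thesis
    by simp
qed

text \<open>A holomorphic logarithm of \<open>f\<close> has real part bounded linearly in \<open>\<bar>z\<bar>\<close>. By the
  Borel-Caratheodory inequality its modulus is bounded linearly too, and Liouville's theorem makes
  it a polynomial of degree at most 1.\<close>

lemma zero_free_exponential_type: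
  fixes f :: "complex \<Rightarrow> complex"
  assumes hol: "f holomorphic_on UNIV" and nz: "\<And>z. f z \<noteq> 0"
    and growth: "\<And>z. norm (f z) \<le> K * exp (D * norm z)" and D: "D \<ge> 0"
  obtains \<alpha> where "\<And>z. f z = f 0 * exp (\<alpha> * z)"
proof -
  obtain g0 where g0: "g0 holomorphic_on UNIV" "\<And>z. f z = exp (g0 z)"
    using contractible_imp_holomorphic_log[OF hol contractible_UNIV nz] by auto
  define g where "g = (\<lambda>z. g0 z - g0 0)"
  have holg: "g holomorphic_on UNIV"
    unfolding g_def by (intro holomorphic_intros g0)
  have f: "f z = f 0 * exp (g z)" for z
    by (simp add: g0(2) g_def exp_diff)
  have "K > 0"
    using growth[of 0] nz[of 0] by (simp add: less_le_trans[OF zero_less_norm_iff[THEN iffD2]])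
  \<comment> \<open>The summand 1 makes the bound on the real part strict, the maximum makes it positive.\<close>
  define L where "L = max 1 (ln K - Re (g0 0) + 1)"
  have "Re (g z) < L + D * norm z" for z
  proof -
    have "exp (Re (g0 z)) \<le> exp (ln K + D * norm z)"
      using growth[of z] \<open>K > 0\<close> by (simp add: g0(2) exp_add)
    then show ?thesis
      by (simp add: g_def L_def)
  qed
  then have Re_g: "Re (g z) < L + D * R" if "norm z < R" for z R
    using that D by (meson add_left_mono less_imp_le less_le_trans mult_left_mono)
  have "L \<ge> 1"
    by (simp add: L_def)
  have "norm (g z) \<le> (2 * L + 4 * D) * norm z ^ 1" if "1 \<le> norm z" for z
  proof -
    have "norm (g z) \<le> 2 * (L + D * (2 * norm z))"
      using that D \<open>L \<ge> 1\<close>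
      by (intro Borel_Caratheodory_half[OF holg, where R = "2 * norm z"] Re_g add_pos_nonneg)
        (auto simp: g_def)
    also have "\<dots> \<le> (2 * L + 4 * D) * norm z ^ 1"
      using mult_left_mono[OF that, of L] \<open>L \<ge> 1\<close> by (simp add: algebra_simps)
    finally show ?thesis .
  qed
  then have poly: "g z = (\<Sum>k\<le>1. (deriv ^^ k) g 0 / fact k * z ^ k)" for z
    by (rule Liouville_polynomial[OF holg])
  have "g 0 = 0"
    by (simp add: g_def)
  then have "g z = deriv g 0 * z" for z
    by (intro trans[OF poly]) simp
  then show ?thesis
    using that f by metis
qed

section \<open>Exponentially bounded sequences\<close>

text \<open>Both claims follow by comparison with the series of \<open>K e\<^bsup>D\<bar>z\<bar>\<^esup>\<close>.\<close>

lemma egf_entire: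
  fixes f :: "nat \<Rightarrow> complex"
  assumes f: "\<And>n. norm (f n) \<le> K * D ^ n"
  shows "fps_conv_radius (egf f) = \<infinity>"
    and "norm (eval_fps (egf f) z) \<le> K * exp (D * norm z)"
proof -
  have le: "norm (egf f $ n * z ^ n) \<le> K * ((D * norm z) ^ n /\<^sub>R fact n)" for n z
  proof -
    have "norm (egf f $ n * z ^ n) = norm (f n) * (norm z ^ n / fact n)"
      by (simp add: norm_mult norm_divide norm_power)
    also have "\<dots> \<le> (K * D ^ n) * (norm z ^ n / fact n)"
      by (intro mult_right_mono f) simp
    finally show ?thesis
      by (simp add: power_mult_distrib divide_inverse mult_ac)
  qed
  have sums: "(\<lambda>n. K * ((D * norm z) ^ n /\<^sub>R fact n)) sums (K * exp (D * norm z))" for z :: complex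
    by (intro sums_mult exp_converges)
  have "summable (\<lambda>n. egf f $ n * z ^ n)" for z
    by (rule summable_comparison_test'[OF sums_summable[OF sums]]) (rule le)
  then show "fps_conv_radius (egf f) = \<infinity>"
    unfolding fps_conv_radius_def by (rule conv_radius_inftyI'')
  show "norm (eval_fps (egf f) z) \<le> K * exp (D * norm z)"
    unfolding eval_fps_def sums_unique[OF sums]
    by (intro norm_suminf_le le sums_summable[OF sums])
qed

text \<open>The exponential has no zeros, so neither has a factor of it; the
  bound on \<open>g\<close> ensures that the identity of power series holds between values at every point.\<close>

lemma egf_factor_of_exp_geometric:
  fixes f g :: "nat \<Rightarrow> complex"
  assumes f: "\<And>n. norm (f n) \<le> K * D ^ n" and "D \<ge> 0"
    and g: "\<And>n. norm (g n) \<le> K' * D' ^ n"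
    and prod: "egf f * egf g = fps_exp w"
  obtains \<alpha> where "\<And>n. f n = f 0 * \<alpha> ^ n"
proof -
  let ?F = "eval_fps (egf f)"
  have nz: "?F z \<noteq> 0" for z
  proof -
    have "?F z * eval_fps (egf g) z = eval_fps (egf f * egf g) z"
      by (subst eval_fps_mult) (simp_all add: egf_entire[OF f] egf_entire[OF g])
    also have "\<dots> = exp (w * z)"
      by (simp add: prod)
    finally show ?thesis
      by auto
  qed
  have hol: "?F holomorphic_on UNIV"
    by (intro holomorphic_on_eval_fps) (simp add: egf_entire[OF f])
  obtain \<alpha> where \<alpha>: "\<And>z. ?F z = ?F 0 * exp (\<alpha> * z)"
    using zero_free_exponential_type[OF hol nz egf_entire(2)[OF f] \<open>D \<ge> 0\<close>] by blast
  have "?F has_fps_expansion egf f"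
    by (intro eval_fps_has_fps_expansion) (simp add: egf_entire[OF f])
  moreover have "(\<lambda>z. f 0 * exp (\<alpha> * z)) has_fps_expansion fps_const (f 0) * fps_exp \<alpha>"
    by (intro fps_expansion_intros)
  moreover have "?F = (\<lambda>z. f 0 * exp (\<alpha> * z))"
    using \<alpha> by (auto simp: eval_fps_at_0)
  ultimately have "egf f = fps_const (f 0) * fps_exp \<alpha>"
    using fps_expansion_unique_complex by metis
  then have "fps_nth (egf f) n = fps_nth (fps_const (f 0) * fps_exp \<alpha>) n" for n
    by (rule arg_cong)
  then have "f n = f 0 * \<alpha> ^ n" for n
    unfolding egf_nth fps_mult_left_const_nth fps_exp_nth of_nat_fact times_divide_eq_right
    by (metis fact_nonzero nonzero_eq_divide_eq divide_eq_eq)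
  then show ?thesis
    by (rule that)
qed

text \<open>An irreducible rational polynomial vanishing at the integer \<open>k\<close> is a constant multiple of
  \<open>X - k\<close>.\<close>

lemma galois_conjugates_of_int: "galois_conjugates (of_int k) = {of_int k}"
proof -
  have eval: "poly (map_poly of_rat p) (of_int m :: complex) = of_rat (poly p (of_int m))" for p m
    by (induction p) (simp_all add: map_poly_pCons of_rat_add of_rat_mult)
  have w: "w = of_int k"
    if "irreducible p" "poly (map_poly of_rat p) (of_int k :: complex) = 0"
       "poly (map_poly of_rat p) w = 0" for p :: "rat poly" and w :: complex
  proof -
    have "[:- of_int k, 1:] dvd p"
      using that(2) by (simp add: eval poly_eq_0_iff_dvd)
    then obtain q where q: "p = [:- of_int k, 1:] * q"
      by (elim dvdE)
    have "\<not> [:- of_int k, 1:] dvd (1 :: rat poly)"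
      by (simp add: is_unit_iff_degree)
    with that(1) q have "q dvd 1"
      by (metis irreducibleD)
    then obtain r where r: "q = [:r:]" "r dvd 1"
      by (auto simp: is_unit_poly_iff)
    then have "r \<noteq> 0"
      by auto
    show ?thesis
      using that(3) r \<open>r \<noteq> 0\<close> by (simp add: q map_poly_pCons of_rat_minus of_rat_mult algebra_simps)
  qed
  have "irreducible [:- of_int k, 1 :: rat:]"
    by (intro irreducible_linear_field_poly) simp
  moreover have "poly (map_poly of_rat [:- of_int k, 1 :: rat:]) (of_int k :: complex) = 0"
    unfolding eval by simp
  ultimately show ?thesis
    using w unfolding galois_conjugates_def by blast
qed

lemma G_function_int_coeff_bound:
  assumes "G_function (Abs_fps (\<lambda>n. of_int (a n)))"
  obtains C :: real where "C \<ge> 1" "\<And>n. \<bar>of_int (a n)\<bar> \<le> C ^ (n + 1)"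
proof -
  have nth: "fps_nth (Abs_fps (\<lambda>n. of_int (a n))) = (\<lambda>n. complex_of_int (a n))"
    by (rule ext) simp
  obtain C where "C \<ge> 1"
    and C: "\<And>n. max_conjugate_modulus (\<lambda>n. of_int (a n)) n \<le> C ^ (n + 1)"
    using assms unfolding G_function_def nth by blast
  have "\<bar>of_int (a n)\<bar> \<le> C ^ (n + 1)" for n
  proof -
    have "\<bar>of_int (a n)\<bar> \<le> max_conjugate_modulus (\<lambda>n. of_int (a n)) n"
      unfolding max_conjugate_modulus_def galois_conjugates_of_int by (intro Max_ge) auto
    with C[of n] show ?thesis
      by linarith
  qed
  with \<open>C \<ge> 1\<close> show ?thesis
    using that by blast
qed

text \<open>The upper limit controls all but finitely many terms; the sum in \<open>K\<close> takes care of the rest.\<close>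

lemma limsup_root_bound:
  fixes u :: "nat \<Rightarrow> real"
  assumes "limsup (\<lambda>n. ereal (root n \<bar>u n\<bar>)) < ereal r" "r > 0"
  obtains K where "\<And>n. \<bar>u n\<bar> \<le> K * r ^ n"
proof -
  have "eventually (\<lambda>n. ereal (root n \<bar>u n\<bar>) < ereal r) sequentially"
    using assms by (intro Limsup_lessD)
  then obtain N where N: "\<And>n. n \<ge> N \<Longrightarrow> root n \<bar>u n\<bar> < r"
    by (auto simp: eventually_sequentially)
  define K where "K = 1 + (\<Sum>n\<le>N. \<bar>u n\<bar> / r ^ n)"
  have K: "K \<ge> 1"
    using \<open>r > 0\<close> by (simp add: K_def sum_nonneg)
  have "\<bar>u n\<bar> \<le> K * r ^ n" for n
  proof (cases "n \<le> N")
    case True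
    then have "\<bar>u n\<bar> / r ^ n \<le> (\<Sum>n\<le>N. \<bar>u n\<bar> / r ^ n)"
      using \<open>r > 0\<close> by (intro member_le_sum) auto
    then have "\<bar>u n\<bar> / r ^ n \<le> K"
      by (simp add: K_def)
    then show ?thesis
      using \<open>r > 0\<close> by (simp add: field_simps)
  next
    case False
    then have "root n \<bar>u n\<bar> ^ n \<le> r ^ n"
      using N[of n] by (intro power_mono) auto
    then have "\<bar>u n\<bar> \<le> 1 * r ^ n"
      using False by (simp add: real_root_pow_pos2)
    also have "\<dots> \<le> K * r ^ n"
      using K \<open>r > 0\<close> by (intro mult_right_mono) auto
    finally show ?thesis .
  qed
  then show ?thesis
    by (rule that)
qed

section \<open>Rigidity\<close>

text \<open>The Newton coefficients of \<open>r\<^sup>n\<close> are \<open>(r - 1)\<^sup>n\<close>, and every prime \<open>p\<close> divides the one of index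
  \<open>p\<close>. So \<open>r - 1\<close> is divisible by every prime.\<close>

lemma primary_geometric_eq_1:
  fixes a :: "nat \<Rightarrow> int"
  assumes a: "primary_pseudo_polynomial a" and geom: "\<And>n. a n = r ^ n"
  shows "r = 1"
proof -
  have dvd: "int p dvd r - 1" if "prime p" for p
  proof -
    have "int p dvd (\<Sum>k\<le>p. (-1) ^ (p - k) * int (p choose k) * a k)"
      by (rule primary_imp_newton_coeff_dvd[OF a that order_refl])
    also have "\<dots> = (r + (-1)) ^ p"
      by (simp only: binomial_ring geom) (simp add: mult_ac)
    finally show ?thesis
      using that by (metis diff_conv_add_uminus prime_dvd_power prime_nat_int_transfer)
  qed
  obtain p where "prime p" "p > nat \<bar>r - 1\<bar>"
    using bigger_prime by blast
  with dvd[of p] show ?thesis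
    using dvd_imp_le_int[of "r - 1" "int p"] by fastforce
qed

theorem theorem5:
  fixes a b :: "nat \<Rightarrow> int" and c u :: "nat \<Rightarrow> real"
  assumes a_ppp: "primary_pseudo_polynomial a"
    and a_0: "a 0 = 1"
    and b_def: "\<And>n. b n = (\<Sum>k=0..n. (-1) ^ (n - k) * int (n choose k) * a k)"
    and c_def: "Abs_fps (\<lambda>n. c n / fact n) = inverse (Abs_fps (\<lambda>n. real_of_int (b n) / fact n))"
    and u_def: "\<And>n. u n = (\<Sum>k=0..n. real (n choose k) * c k)"
  shows "(\<exists>U :: nat \<Rightarrow> int. (\<forall>n. u n = real_of_int (U n)) \<and> primary_pseudo_polynomial U) \<and>
    (G_function (Abs_fps (\<lambda>n. of_int (a n))) \<longrightarrow>
      limsup (\<lambda>n. ereal (root n \<bar>u n\<bar>)) < ereal (exp 1) \<longrightarrow>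
      (\<forall>n. a n = 1 \<and> u n = 1))"
proof -
  define A B where "A = egf (\<lambda>n. real_of_int (a n))" and "B = egf (\<lambda>n. real_of_int (b n))"
  have b_sum: "b n = (\<Sum>k\<le>n. (-1) ^ (n - k) * int (n choose k) * a k)" for n
    by (simp add: b_def atLeast0AtMost)
  have b0: "b 0 = 1"
    by (simp add: b_sum a_0)
  have C: "egf c = inverse B"
    using c_def by (simp add: B_def egf_def)
  have BC: "B * egf c = 1"
    unfolding C by (rule inverse_mult_eq_1') (simp add: B_def b0)
  have B: "B = A * fps_exp (-1)"
    unfolding A_def B_def egf_power[symmetric] egf_mult egf_eq_iff
    by (rule ext) (simp add: b_sum mult_ac)
  have U: "egf u = egf c * fps_exp 1"
    unfolding egf_power[symmetric] egf_mult egf_eq_iff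
    by (rule ext) (simp add: u_def atLeast0AtMost)
  have AU: "A * egf u = fps_exp 2"
  proof -
    have "fps_exp (-1) * fps_exp 1 = (1 :: real fps)"
      by (simp flip: fps_exp_add_mult)
    then have "A = B * fps_exp 1"
      by (simp add: B mult.assoc)
    then have "A * egf u = B * fps_exp 1 * (egf c * fps_exp 1)"
      by (simp only: U)
    also have "\<dots> = B * egf c * (fps_exp 1 * fps_exp 1)"
      by (simp only: mult_ac)
    finally have "A * egf u = B * egf c * (fps_exp 1 * fps_exp 1)" .
    then show ?thesis
      by (simp add: BC flip: fps_exp_add_mult)
  qed
  have conv: "(\<Sum>k\<le>n. real (n choose k) * of_int (b k) * c (n - k)) = 0" if "n > 0" for n
  proof -
    have "fps_nth (B * egf c) n = 0"
      using that by (simp add: BC)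
    then show ?thesis
      unfolding B_def egf_mult by simp
  qed
  obtain d where d: "\<And>n. c n = of_int (d n)"
    using reciprocal_egf_coeff_int[OF b0 BC[unfolded B_def]] by blast
  have dvd_d: "int p dvd d n" if "prime p" "p \<le> n" for p n
  proof (rule reciprocal_egf_coeff_dvd[where b = b and d = d, OF b0 _ that(1) _ that(2)])
    fix n :: nat assume "n > 0"
    from conv[OF this] have "real_of_int (\<Sum>k\<le>n. int (n choose k) * b k * d (n - k)) = real_of_int 0"
      by (simp add: d)
    then show "(\<Sum>k\<le>n. int (n choose k) * b k * d (n - k)) = 0"
      by (simp only: of_int_eq_iff)
  next
    show "int p dvd b n" if "p \<le> n" for n
      unfolding b_sum by (rule primary_imp_newton_coeff_dvd[OF a_ppp \<open>prime p\<close> that])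
  qed
  define V where "V = (\<lambda>n. \<Sum>k\<le>n. int (n choose k) * d k)"
  have V: "u n = of_int (V n)" for n
    by (simp add: u_def V_def d atLeast0AtMost)
  have V_ppp: "primary_pseudo_polynomial V"
    unfolding V_def by (rule newton_coeff_dvd_imp_primary) (rule dvd_d)
  have "a n = 1 \<and> u n = 1"
    if G: "G_function (Abs_fps (\<lambda>n. of_int (a n)))"
      and limsup: "limsup (\<lambda>n. ereal (root n \<bar>u n\<bar>)) < ereal (exp 1)" for n
  proof -
    obtain D :: real where D: "D \<ge> 1" "\<And>n. \<bar>of_int (a n)\<bar> \<le> D ^ (n + 1)"
      using G_function_int_coeff_bound[OF G] by blast
    obtain K where K: "\<And>n. \<bar>u n\<bar> \<le> K * exp 1 ^ n"
      using limsup_root_bound[OF limsup] by auto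
    \<comment> \<open>The relation \<open>A U = e\<^sup>2\<^sup>x\<close> is transferred to complex coefficients as a numerical identity.\<close>
    have "egf (\<lambda>n. of_int (a n)) * egf (\<lambda>n. complex_of_real (u n)) = fps_exp 2"
    proof -
      have "A * egf u = egf (\<lambda>n. 2 ^ n)"
        by (simp add: AU egf_power)
      then have "(\<lambda>n. \<Sum>k\<le>n. of_nat (n choose k) * real_of_int (a k) * u (n - k)) = (\<lambda>n. 2 ^ n)"
        unfolding A_def egf_mult egf_eq_iff .
      then have "complex_of_real (\<Sum>k\<le>n. of_nat (n choose k) * real_of_int (a k) * u (n - k)) =
          complex_of_real (2 ^ n)" for n
        by metis
      then show ?thesis
        unfolding egf_mult egf_power[symmetric] egf_eq_iff by (intro ext) simp
    qed
    moreover have "cmod (of_int (a n)) \<le> D * D ^ n" "cmod (of_real (u n)) \<le> K * exp 1 ^ n" for n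
      using D(2)[of n] K[of n] by simp_all
    ultimately obtain \<alpha> where "\<And>n. complex_of_int (a n) = of_int (a 0) * \<alpha> ^ n"
      using egf_factor_of_exp_geometric[of "\<lambda>n. of_int (a n)" D D "\<lambda>n. of_real (u n)" K "exp 1" 2]
        D(1) by fastforce
    then have \<alpha>: "complex_of_int (a n) = \<alpha> ^ n" for n
      by (simp add: a_0)
    have "complex_of_int (a n) = of_int (a 1 ^ n)" for n
      using \<alpha>[of n] \<alpha>[of 1] by simp
    then have geom: "a n = a 1 ^ n" for n
      unfolding of_int_eq_iff .
    have "a 1 = 1"
      by (rule primary_geometric_eq_1[OF a_ppp geom])
    then have a_1: "a n = 1" for n
      using geom[of n] by simp
    have "A = fps_exp 1"
      using egf_power[of "1 :: real"] by (simp add: A_def a_1)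
    then have "fps_exp 1 * egf u = fps_exp 1 * fps_exp 1"
      using AU by (simp flip: fps_exp_add_mult)
    then have "egf u = egf (\<lambda>n. 1 ^ n)"
      unfolding egf_power by simp
    then have "u = (\<lambda>n. 1 ^ n)"
      by (simp only: egf_eq_iff)
    then show ?thesis
      by (simp add: a_1)
  qed
  then show ?thesis
    using V V_ppp by blast
qed

end
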